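(* Let $\hat{\mathbf x}_1,\hat{\mathbf x}_2,\hat{\mathbf x}_3$ be three finite points of $\mathrm P\mathbb R^2$ and $\mathbf l_1,\mathbf l_2$ two lines of $\mathrm P\mathbb R^2$ such that the three points and two lines are in general position, $\hat{\mathbf x}_1^T\mathbf l_i\neq0$ for $i=1,2$, and $\hat{\mathbf x}_2,\hat{\mathbf x}_3,\mathbf l_1\times\mathbf l_2$ are collinear. Then the problem of determining a non-degenerate conic $\mathbf C$ such that $\hat{\mathbf x}_i^T\mathbf C\hat{\mathbf x}_i=0$ for $i=1,2,3$ and $\mathbf l_j^T\mathbf C^{-1}\mathbf l_j=0$ for $j=1,2$ has two distinct real solutions if and only if $(\hat{\mathbf x}_1^T\mathbf l_1)(\hat{\mathbf x}_3^T\mathbf l_1)$ and $(\hat{\mathbf x}_1^T\mathbf l_2)(\hat{\mathbf x}_3^T\mathbf l_2)$ have the same sign.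
   Context: $\mathrm P\mathbb R^2$ is the real projective plane. A hat denotes a finite point in normalized homogeneous coordinates, i.e. a vector of $\mathbb R^3$ whose third component is $1$. A line is given by a nonzero vector $\mathbf l\in\mathbb R^3$ (up to scale), and $\mathbf x$ lies on $\mathbf l$ iff $\mathbf x^T\mathbf l=0$; the two lines are distinct and the cross product $\mathbf l_1\times\mathbf l_2$ is their intersection point. A side of a triangle is the full line through two of its vertices. Three points and two lines are in general position if the three points are non-collinear, neither $\mathbf l_1$ nor $\mathbf l_2$ is a side of the triangle $\hat{\mathbf x}_1\hat{\mathbf x}_2\hat{\mathbf x}_3$, and the intersection point of $\mathbf l_1$ and $\mathbf l_2$ is not a vertex of that triangle. A conic is a nonzero symmetric $3\times3$ matrix (complex entries allowed) up to nonzero scale; it is non-degenerate if its determinant is nonzero and real if it can be represented by a real matrix. Solutions are counted up to scale. *)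

theory Defs
  imports "HOL-Analysis.Analysis"
begin

text \<open>Points and lines of the real projective plane are both represented by nonzero vectors of
  \<^typ>\<open>real^3\<close> up to scale.\<close>

definition proj_eq :: "real^3 \<Rightarrow> real^3 \<Rightarrow> bool" where
  "proj_eq a b \<longleftrightarrow> (\<exists>c. c \<noteq> 0 \<and> b = c *\<^sub>R a)"

definition finite_point :: "real^3 \<Rightarrow> bool" where
  "finite_point x \<longleftrightarrow> x $ 3 = 1"

definition on_line :: "real^3 \<Rightarrow> real^3 \<Rightarrow> bool" where
  "on_line x l \<longleftrightarrow> x \<bullet> l = 0"

text \<open>Projective collinearity. The library constant \<^const>\<open>collinear\<close> is affine collinearity in the
  ambient space \<^typ>\<open>real^3\<close> and is not invariant under rescaling the homogeneous coordinates.\<close>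

definition proj_collinear :: "real^3 \<Rightarrow> real^3 \<Rightarrow> real^3 \<Rightarrow> bool" where
  "proj_collinear x y z \<longleftrightarrow> (\<exists>l. l \<noteq> 0 \<and> on_line x l \<and> on_line y l \<and> on_line z l)"

definition is_side :: "real^3 \<Rightarrow> real^3 \<Rightarrow> real^3 \<Rightarrow> real^3 \<Rightarrow> bool" where
  "is_side l x y z \<longleftrightarrow>
     on_line x l \<and> on_line y l \<or> on_line y l \<and> on_line z l \<or> on_line z l \<and> on_line x l"

definition is_vertex :: "real^3 \<Rightarrow> real^3 \<Rightarrow> real^3 \<Rightarrow> real^3 \<Rightarrow> bool" where
  "is_vertex p x y z \<longleftrightarrow> proj_eq p x \<or> proj_eq p y \<or> proj_eq p z"

definition general_position ::
  "real^3 \<Rightarrow> real^3 \<Rightarrow> real^3 \<Rightarrow> real^3 \<Rightarrow> real^3 \<Rightarrow> bool" where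
  "general_position x1 x2 x3 l1 l2 \<longleftrightarrow>
     \<not> proj_collinear x1 x2 x3 \<and>
     \<not> is_side l1 x1 x2 x3 \<and> \<not> is_side l2 x1 x2 x3 \<and>
     \<not> is_vertex (cross3 l1 l2) x1 x2 x3"

text \<open>\<open>map_matrix ((*) c) M\<close> is the scalar multiple of the matrix \<open>M\<close> by \<open>c\<close>: on \<^typ>\<open>complex^3^3\<close>
  the library operation \<open>*s\<close> would take a row vector as its scalar.\<close>

definition conic_eq :: "complex^3^3 \<Rightarrow> complex^3^3 \<Rightarrow> bool" where
  "conic_eq M N \<longleftrightarrow> M \<noteq> 0 \<and> transpose M = M \<and> N \<noteq> 0 \<and> transpose N = N \<and>
     (\<exists>c. c \<noteq> 0 \<and> N = map_matrix ((*) c) M)"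

text \<open>The relation is reflexive exactly on the nonzero symmetric matrices, so the partial quotient
  consists of the nonzero symmetric complex matrices up to nonzero complex scale.\<close>

quotient_type conic = "complex^3^3" / partial: conic_eq
proof (rule part_equivpI)
  have "conic_eq (mat 1) (mat 1)"
    unfolding conic_eq_def
    by (auto simp: vec_eq_iff mat_def transpose_def intro!: exI[of _ 1])
  then show "\<exists>M. conic_eq M M" ..
  show "symp conic_eq"
  proof (rule sympI)
    fix M N assume "conic_eq M N"
    moreover from this obtain c where "c \<noteq> 0" "N = map_matrix ((*) c) M"
      by (auto simp: conic_eq_def)
    then have "M = map_matrix ((*) (inverse c)) N"
      by (simp add: vec_eq_iff)
    ultimately show "conic_eq N M"
      using \<open>c \<noteq> 0\<close> by (auto simp: conic_eq_def intro!: exI[of _ "inverse c"])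
  qed
  show "transp conic_eq"
  proof (rule transpI)
    fix M N P assume "conic_eq M N" "conic_eq N P"
    moreover from this obtain c d where "c \<noteq> 0" "N = map_matrix ((*) c) M"
      "d \<noteq> 0" "P = map_matrix ((*) d) N"
      by (auto simp: conic_eq_def)
    then have "d * c \<noteq> 0" "P = map_matrix ((*) (d * c)) M"
      by (simp_all add: vec_eq_iff)
    ultimately show "conic_eq M P"
      unfolding conic_eq_def by blast
  qed
qed

definition complex_vec :: "real^3 \<Rightarrow> complex^3" where
  "complex_vec v = (\<chi> i. complex_of_real (v $ i))"

text \<open>\<open>quad_form M v\<close> is \<open>v\<^sup>T M v\<close>, without complex conjugation.\<close>

definition quad_form :: "complex^3^3 \<Rightarrow> complex^3 \<Rightarrow> complex" where
  "quad_form M v = scalar_product v (M *v v)"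

lemma quad_form_scale: "quad_form (map_matrix ((*) c) M) v = c * quad_form M v"
  by (simp add: quad_form_def scalar_product_def matrix_vector_mult_def sum_3 algebra_simps)

lemma det_scale: "det (map_matrix ((*) c) M) = c ^ 3 * det M" for M :: "complex^3^3"
  by (simp add: det_3 power3_eq_cube algebra_simps)

lemma matrix_inv_scale:
  fixes M :: "complex^3^3"
  assumes "c \<noteq> 0" "det M \<noteq> 0"
  shows "matrix_inv (map_matrix ((*) c) M) = map_matrix ((*) (inverse c)) (matrix_inv M)"
proof -
  have "invertible M"
    using assms by (simp add: invertible_det_nz)
  then have *: "M ** matrix_inv M = mat 1" "matrix_inv M ** M = mat 1"
    unfolding invertible_def matrix_inv_def by (metis (mono_tags, lifting) someI_ex)+
  have scale: "map_matrix ((*) a) A ** map_matrix ((*) b) B = map_matrix ((*) (a * b)) (A ** B)"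
    for a b and A B :: "complex^3^3"
    by (simp add: vec_eq_iff matrix_matrix_mult_def sum_3 algebra_simps)
  let ?A = "map_matrix ((*) c) M" and ?B = "map_matrix ((*) (inverse c)) (matrix_inv M)"
  have B: "?A ** ?B = mat 1" "?B ** ?A = mat 1"
    using assms by (simp_all add: scale *) (simp_all add: vec_eq_iff)
  then have "?A ** matrix_inv ?A = mat 1 \<and> matrix_inv ?A ** ?A = mat 1"
    unfolding matrix_inv_def by (metis (mono_tags, lifting) someI_ex)
  then show ?thesis
    using B by (metis matrix_mul_assoc matrix_mul_lid matrix_mul_rid)
qed

lift_definition nondegenerate :: "conic \<Rightarrow> bool" is "\<lambda>M. det M \<noteq> 0"
  by (auto simp: conic_eq_def det_scale)

lift_definition real_conic :: "conic \<Rightarrow> bool" is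
  "\<lambda>M. \<exists>A :: real^3^3. conic_eq M (map_matrix complex_of_real A)"
  using conic_equivp by (meson part_equivp_symp part_equivp_transp)

lift_definition passes_through :: "conic \<Rightarrow> real^3 \<Rightarrow> bool" is
  "\<lambda>M x. quad_form M (complex_vec x) = 0"
  by (auto simp: conic_eq_def quad_form_scale)

text \<open>Non-degeneracy is part of the condition because \<^const>\<open>matrix_inv\<close> is unspecified on singular
  matrices.\<close>

lift_definition tangent_to :: "conic \<Rightarrow> real^3 \<Rightarrow> bool" is
  "\<lambda>M l. det M \<noteq> 0 \<and> quad_form (matrix_inv M) (complex_vec l) = 0"
  by (auto simp: conic_eq_def det_scale matrix_inv_scale quad_form_scale)

definition conic_solutions ::
  "real^3 \<Rightarrow> real^3 \<Rightarrow> real^3 \<Rightarrow> real^3 \<Rightarrow> real^3 \<Rightarrow> conic set" where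
  "conic_solutions x1 x2 x3 l1 l2 =
     {C. nondegenerate C \<and>
         passes_through C x1 \<and> passes_through C x2 \<and> passes_through C x3 \<and>
         tangent_to C l1 \<and> tangent_to C l2}"

end

theory Submission
  imports Defs
begin

text \<open>
  In coordinates with the three points as vertices of the coordinate triangle, a line \<open>l\<close> becomes
  the vector of incidences \<open>(p, q, r) = (x1 \<bullet> l, x2 \<bullet> l, x3 \<bullet> l)\<close>, and a non-degenerate conic through
  the points is, up to scale, \<open>y z + b x z + c x y = 0\<close> with \<open>b, c \<noteq> 0\<close>. It touches the line iff
  \<open>p\<^sup>2 + b\<^sup>2 q\<^sup>2 + c\<^sup>2 r\<^sup>2 - 2 b p q - 2 c p r - 2 b c q r = 0\<close>.

  Since the two lines meet on the side through \<open>x2\<close> and \<open>x3\<close>, and not in a vertex, \<open>q / r\<close> is the same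
  nonzero number \<open>s\<close> for both of them. They differ only in the ratio \<open>p / r\<close>, which takes
  two distinct nonzero values \<open>P\<close> and \<open>Q\<close>. Tangency to both lines says that \<open>P\<close> and \<open>Q\<close> are the roots of
  one quadratic polynomial, \<open>t\<^sup>2 - 2 (b s + c) t + (b s - c)\<^sup>2\<close>. By Vieta,
  \<open>2 (b s + c) = P + Q\<close> and \<open>(b s - c)\<^sup>2 = P Q\<close>. Over the reals this has no solution when \<open>P Q < 0\<close>, and
  when \<open>P Q > 0\<close> the two signs of the square root give two solutions; both have \<open>b, c \<noteq> 0\<close> because
  \<open>(P + Q)\<^sup>2 \<noteq> 4 P Q\<close>. The sign of \<open>P\<close> is that of \<open>p r\<close> for the first line, and likewise for \<open>Q\<close>,
  which gives the criterion.

  The lemma \<open>bij_betw_circumconics_solutions\<close> identifies the real solutions with the pairs \<open>(b, c)\<close>,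
  and \<open>card_tangent_circumconics_eq_2_iff\<close> counts these pairs.
\<close>

section \<open>Real conics\<close>

definition conic_of :: "real^3^3 \<Rightarrow> conic" where
  "conic_of A = abs_conic (map_matrix complex_of_real A)"

lemma map_matrix_of_real_eq_0_iff [simp]:
  "map_matrix complex_of_real (A :: real^3^3) = 0 \<longleftrightarrow> A = 0"
  by (simp add: vec_eq_iff)

lemma transpose_map_matrix_of_real_iff:
  "transpose (map_matrix complex_of_real (A :: real^3^3)) = map_matrix complex_of_real A \<longleftrightarrow>
     transpose A = A"
  by (simp add: vec_eq_iff transpose_def)

lemma det_map_matrix_of_real:
  "det (map_matrix complex_of_real (A :: real^3^3)) = of_real (det A)"
  by (simp add: det_3)

lemma map_matrix_of_real_mult_vec:
  "map_matrix complex_of_real A *v complex_vec v = complex_vec (A *v v)"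
  by (simp add: vec_eq_iff complex_vec_def matrix_vector_mult_def)

lemma scalar_product_complex_vec:
  "scalar_product (complex_vec v) (complex_vec w) = of_real (v \<bullet> w)"
  by (simp add: scalar_product_def complex_vec_def inner_vec_def)

text \<open>If a complex multiple of a nonzero real matrix is real, then the factor may be replaced by its
  real part. This lets all uniqueness questions about real conics be settled with real matrices.\<close>

lemma conic_eq_map_matrix_of_real_iff:
  fixes A B :: "real^3^3"
  shows "conic_eq (map_matrix complex_of_real A) (map_matrix complex_of_real B) \<longleftrightarrow>
    A \<noteq> 0 \<and> transpose A = A \<and> B \<noteq> 0 \<and> transpose B = B \<and> (\<exists>c. c \<noteq> 0 \<and> B = c *\<^sub>R A)"
proof -
  have "(\<exists>z. z \<noteq> 0 \<and> map_matrix complex_of_real B = map_matrix ((*) z) (map_matrix complex_of_real A))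
      \<longleftrightarrow> (\<exists>c. c \<noteq> 0 \<and> B = c *\<^sub>R A)" if "B \<noteq> 0"
  proof
    assume "\<exists>z. z \<noteq> 0 \<and> map_matrix complex_of_real B = map_matrix ((*) z) (map_matrix complex_of_real A)"
    then obtain z where z: "\<And>i j. complex_of_real (B $ i $ j) = z * complex_of_real (A $ i $ j)"
      by (auto simp: vec_eq_iff)
    have "B $ i $ j = Re z * A $ i $ j" for i j
      using arg_cong[OF z[of i j], of Re] by simp
    then have "B = Re z *\<^sub>R A"
      by (simp add: vec_eq_iff)
    with that show "\<exists>c. c \<noteq> 0 \<and> B = c *\<^sub>R A"
      by (metis scaleR_zero_left)
  next
    assume "\<exists>c. c \<noteq> 0 \<and> B = c *\<^sub>R A"
    then obtain c where "c \<noteq> 0" "B = c *\<^sub>R A"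
      by blast
    then show "\<exists>z. z \<noteq> 0 \<and> map_matrix complex_of_real B = map_matrix ((*) z) (map_matrix complex_of_real A)"
      by (intro exI[of _ "complex_of_real c"]) (simp add: vec_eq_iff)
  qed
  then show ?thesis
    by (auto simp only: conic_eq_def transpose_map_matrix_of_real_iff map_matrix_of_real_eq_0_iff)
qed

lemma conic_eq_map_matrix_of_real_refl:
  assumes "A \<noteq> 0" "transpose A = A"
  shows "conic_eq (map_matrix complex_of_real A) (map_matrix complex_of_real A)"
  using assms by (auto simp: conic_eq_map_matrix_of_real_iff intro!: exI[of _ 1])

lemma conic_of_eq_iff:
  assumes "A \<noteq> 0" "transpose A = A" "B \<noteq> 0" "transpose B = B"
  shows "conic_of A = conic_of B \<longleftrightarrow> (\<exists>c. c \<noteq> 0 \<and> B = c *\<^sub>R A)"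
proof -
  let ?M = "map_matrix complex_of_real A" and ?N = "map_matrix complex_of_real B"
  have "conic_of A = conic_of B \<longleftrightarrow> conic_eq ?M ?N"
    unfolding conic_of_def
    using Quotient3_rel[OF Quotient3_conic, of ?M ?N]
      conic_eq_map_matrix_of_real_refl[OF assms(1,2)] conic_eq_map_matrix_of_real_refl[OF assms(3,4)]
    by blast
  then show ?thesis
    using assms by (simp only: conic_eq_map_matrix_of_real_iff) blast
qed

lemma real_conic_conic_of:
  assumes "A \<noteq> 0" "transpose A = A"
  shows "real_conic (conic_of A)"
  using conic_eq_map_matrix_of_real_refl[OF assms]
  by (auto simp: conic_of_def real_conic.abs_eq)

lemma real_conicE:
  assumes "real_conic C"
  obtains A where "A \<noteq> 0" "transpose A = A" "C = conic_of A"
proof -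
  obtain A where A: "conic_eq (rep_conic C) (map_matrix complex_of_real A)"
    using assms by (auto simp: real_conic.rep_eq)
  then have "A \<noteq> 0" "transpose A = A"
    by (auto simp only: conic_eq_def transpose_map_matrix_of_real_iff map_matrix_of_real_eq_0_iff)
  moreover have "C = conic_of A"
    using Quotient3_rel_abs[OF Quotient3_conic A] Quotient3_abs_rep[OF Quotient3_conic]
    by (simp add: conic_of_def)
  ultimately show thesis
    by (rule that)
qed

lemma nondegenerate_conic_of_iff:
  assumes "A \<noteq> 0" "transpose A = A"
  shows "nondegenerate (conic_of A) \<longleftrightarrow> det A \<noteq> 0"
  using conic_eq_map_matrix_of_real_refl[OF assms]
  by (simp add: conic_of_def nondegenerate.abs_eq det_map_matrix_of_real)

lemma passes_through_conic_of_iff: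
  assumes "A \<noteq> 0" "transpose A = A"
  shows "passes_through (conic_of A) x \<longleftrightarrow> x \<bullet> (A *v x) = 0"
  using conic_eq_map_matrix_of_real_refl[OF assms]
  by (simp add: conic_of_def passes_through.abs_eq quad_form_def map_matrix_of_real_mult_vec
      scalar_product_complex_vec)

text \<open>The vector \<open>w\<close> is the pole of the line, and a line is tangent iff it contains its pole. Working
  with the pole avoids computing an inverse matrix.\<close>

lemma tangent_to_conic_of_iff:
  assumes "transpose A = A" "det A \<noteq> 0" "A *v w = l"
  shows "tangent_to (conic_of A) l \<longleftrightarrow> l \<bullet> w = 0"
proof -
  let ?M = "map_matrix complex_of_real A"
  have "A \<noteq> 0"
    using assms(2) by (auto simp: det_3)
  note refl = conic_eq_map_matrix_of_real_refl[OF this assms(1)]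
  have "det ?M \<noteq> 0"
    using assms(2) by (simp add: det_map_matrix_of_real)
  then have "\<exists>B. ?M ** B = mat 1 \<and> B ** ?M = mat 1"
    using invertible_det_nz[of ?M] by (auto simp: invertible_def)
  then have "matrix_inv ?M ** ?M = mat 1"
    unfolding matrix_inv_def by (metis (mono_tags, lifting) someI_ex)
  moreover have "complex_vec l = ?M *v complex_vec w"
    by (simp add: map_matrix_of_real_mult_vec assms(3))
  ultimately have "matrix_inv ?M *v complex_vec l = complex_vec w"
    by (simp add: matrix_vector_mul_assoc)
  then show ?thesis
    using refl \<open>det ?M \<noteq> 0\<close>
    by (simp add: conic_of_def tangent_to.abs_eq quad_form_def scalar_product_complex_vec)
qed

section \<open>Conics circumscribed to the coordinate triangle\<close>

text \<open>The conics \<open>y z + b x z + c x y = 0\<close>. The coefficient of \<open>y z\<close> does not vanish on a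
  non-degenerate conic through the vertices, so it is normalised to \<open>1\<close>, which leaves
  a unique representative for each conic.\<close>

definition circumconic :: "real \<Rightarrow> real \<Rightarrow> real^3^3" where
  "circumconic b c = vector [vector [0, c, b], vector [c, 0, 1], vector [b, 1, 0]]"

text \<open>Minus the quadratic form of the adjugate of \<open>circumconic b c\<close>, i.e. the dual conic.\<close>

definition tangency :: "real \<Rightarrow> real \<Rightarrow> real^3 \<Rightarrow> real" where
  "tangency b c m =
     (m$1)\<^sup>2 + b\<^sup>2 * (m$2)\<^sup>2 + c\<^sup>2 * (m$3)\<^sup>2
     - 2 * b * m$1 * m$2 - 2 * c * m$1 * m$3 - 2 * b * c * m$2 * m$3"

lemma circumconic_nth [simp]:
  "circumconic b c $ 1 $ 1 = 0" "circumconic b c $ 1 $ 2 = c" "circumconic b c $ 1 $ 3 = b"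
  "circumconic b c $ 2 $ 1 = c" "circumconic b c $ 2 $ 2 = 0" "circumconic b c $ 2 $ 3 = 1"
  "circumconic b c $ 3 $ 1 = b" "circumconic b c $ 3 $ 2 = 1" "circumconic b c $ 3 $ 3 = 0"
  by (simp_all add: circumconic_def)

lemma transpose_circumconic: "transpose (circumconic b c) = circumconic b c"
  by (simp add: vec_eq_iff transpose_def forall_3)

lemma det_circumconic: "det (circumconic b c) = 2 * b * c"
  by (simp add: det_3)

text \<open>For the adjugate \<open>N'\<close> of a symmetric matrix \<open>N\<close> one has \<open>N N' N = (det N) N\<close>, so the dual form at the
  polar of \<open>u\<close> is a multiple of the form at \<open>u\<close>.\<close>

lemma tangency_circumconic_image:
  "tangency b c (circumconic b c *v u) = - 2 * b * c * (u \<bullet> (circumconic b c *v u))"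
  by (simp add: tangency_def matrix_vector_mult_def inner_vec_def sum_3 power2_eq_square algebra_simps)

lemma symmetric_zero_diagonal_eq_circumconic:
  fixes N :: "real^3^3"
  assumes "transpose N = N" "N$1$1 = 0" "N$2$2 = 0" "N$3$3 = 0" "det N \<noteq> 0"
  obtains a b c where "a \<noteq> 0" "b \<noteq> 0" "c \<noteq> 0" "N = a *\<^sub>R circumconic b c"
proof -
  have sym: "N$2$1 = N$1$2" "N$3$1 = N$1$3" "N$3$2 = N$2$3"
    using assms(1) by (simp_all add: vec_eq_iff transpose_def)
  have nz: "N$1$2 \<noteq> 0" "N$1$3 \<noteq> 0" "N$2$3 \<noteq> 0"
    using assms(2-5) sym by (auto simp: det_3)
  show thesis
  proof (rule that[of "N$2$3" "N$1$3 / N$2$3" "N$1$2 / N$2$3"])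
    show "N = N$2$3 *\<^sub>R circumconic (N$1$3 / N$2$3) (N$1$2 / N$2$3)"
      using nz sym assms(2-4) by (simp add: vec_eq_iff forall_3)
  qed (use nz in auto)
qed

section \<open>Change of coordinates to the triangle of the three points\<close>

text \<open>When the rows of \<open>R\<close> are the three points, the diagonal of the congruent matrix decides whether
  the conic passes through them.\<close>

lemma congruence_nth:
  fixes A :: "real^3^3"
  shows "(R ** A ** transpose R) $ i $ j = R$i \<bullet> (A *v R$j)"
  by (simp add: matrix_matrix_mult_def matrix_vector_mult_def transpose_def inner_vec_def sum_3
      algebra_simps)

lemma congruence_scaleR:
  fixes A :: "real^3^3"
  shows "R ** (k *\<^sub>R A) ** transpose R = k *\<^sub>R (R ** A ** transpose R)"
  by (simp only: matrix_scalar_ac scalar_matrix_assoc)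

lemma tangent_to_iff_tangency:
  assumes "R ** S = mat 1" "S ** R = mat 1" "b \<noteq> 0" "c \<noteq> 0"
  shows "tangent_to (conic_of (S ** circumconic b c ** transpose S)) l \<longleftrightarrow> tangency b c (R *v l) = 0"
proof -
  let ?N = "circumconic b c"
  let ?A = "S ** ?N ** transpose S"
  have "det S \<noteq> 0"
    using assms(1) by (metis det_I det_mul mult_zero_right zero_neq_one)
  then have "det ?A \<noteq> 0"
    using assms(3,4) by (simp add: det_mul det_circumconic)
  moreover have "transpose ?A = ?A"
    by (simp add: matrix_transpose_mul transpose_circumconic matrix_mul_assoc)
  moreover
  obtain w where w: "?A *v w = l"
    using \<open>det ?A \<noteq> 0\<close> by (metis invertible_det_nz invertible_def matrix_vector_mul_assoc matrix_vector_mul_lid)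
  ultimately have "tangent_to (conic_of ?A) l \<longleftrightarrow> l \<bullet> w = 0"
    by (intro tangent_to_conic_of_iff)
  moreover
  let ?u = "transpose S *v w"
  have l: "l = S *v (?N *v ?u)"
    using w by (simp add: matrix_vector_mul_assoc matrix_mul_assoc del: transpose_matrix_vector)
  moreover have "l \<bullet> w = ?u \<bullet> (?N *v ?u)"
    by (metis l dot_lmul_matrix inner_commute vector_transpose_matrix transpose_transpose)
  moreover have "?u \<bullet> (?N *v ?u) = 0 \<longleftrightarrow> tangency b c (?N *v ?u) = 0"
    using assms(3,4) by (simp add: tangency_circumconic_image)
  moreover have "?N *v ?u = R *v l"
    using assms(1) by (metis l matrix_vector_mul_assoc matrix_vector_mul_lid)
  ultimately show ?thesis
    by simp
qed

text \<open>The inverse map sends a real conic with matrix \<open>A\<close> to the matrix \<open>R A R\<^sup>T\<close> of the conic in triangle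
  coordinates, which has zero diagonal and is therefore a multiple of exactly one normalised
  \<open>circumconic b c\<close>.\<close>

lemma bij_betw_circumconics_solutions:
  assumes RS: "(vector [x1, x2, x3] :: real^3^3) ** S = mat 1" "S ** vector [x1, x2, x3] = mat 1"
  shows "bij_betw (\<lambda>(b, c). conic_of (S ** circumconic b c ** transpose S))
    {(b, c). b \<noteq> 0 \<and> c \<noteq> 0 \<and> tangency b c (vector [x1, x2, x3] *v l1) = 0 \<and>
       tangency b c (vector [x1, x2, x3] *v l2) = 0}
    {C \<in> conic_solutions x1 x2 x3 l1 l2. real_conic C}"
    (is "bij_betw ?f ?P ?Q")
proof -
  define R :: "real^3^3" where "R = vector [x1, x2, x3]"
  note RS = RS[folded R_def]
  have R [simp]: "R$1 = x1" "R$2 = x2" "R$3 = x3"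
    by (simp_all add: R_def)
  define g where "g b c = S ** circumconic b c ** transpose S" for b c
  have tRS: "transpose S ** transpose R = mat 1" "transpose R ** transpose S = mat 1"
    using RS by (metis matrix_transpose_mul transpose_mat)+
  have pull: "R ** g b c ** transpose R = circumconic b c" for b c
    using RS tRS by (simp add: g_def matrix_mul_assoc) (simp add: matrix_mul_assoc[symmetric])
  have push: "S ** (R ** A ** transpose R) ** transpose S = A" for A
    using RS tRS by (simp add: matrix_mul_assoc) (simp add: matrix_mul_assoc[symmetric])
  have detS: "det S \<noteq> 0" and detR: "det R \<noteq> 0"
    using RS(1) by (metis det_I det_mul mult_zero_right mult_zero_left zero_neq_one)+
  have sym_g: "transpose (g b c) = g b c" for b c
    by (simp add: g_def matrix_transpose_mul transpose_circumconic matrix_mul_assoc)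
  have g_nz: "g b c \<noteq> 0" for b c
  proof
    assume "g b c = 0"
    then have "circumconic b c = 0"
      using pull[of b c] by simp
    then show False
      using circumconic_nth(6)[of b c] by (simp del: circumconic_nth)
  qed
  have pass: "passes_through (conic_of (g b c)) x1" "passes_through (conic_of (g b c)) x2"
    "passes_through (conic_of (g b c)) x3" for b c
    using congruence_nth[of R "g b c" 1 1] congruence_nth[of R "g b c" 2 2]
      congruence_nth[of R "g b c" 3 3]
    by (simp_all add: pull passes_through_conic_of_iff[OF g_nz sym_g])
  have nondeg: "nondegenerate (conic_of (g b c)) \<longleftrightarrow> b \<noteq> 0 \<and> c \<noteq> 0" for b c
    using detS by (simp add: nondegenerate_conic_of_iff[OF g_nz sym_g])
      (simp add: g_def det_mul det_circumconic)
  have tang: "tangent_to (conic_of (g b c)) l \<longleftrightarrow> tangency b c (R *v l) = 0"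
    if "b \<noteq> 0" "c \<noteq> 0" for b c l
    using tangent_to_iff_tangency[OF RS that] by (simp add: g_def)
  have inj: "b = b' \<and> c = c'" if eq: "conic_of (g b c) = conic_of (g b' c')" for b c b' c'
  proof -
    from eq obtain k where "g b' c' = k *\<^sub>R g b c"
      using conic_of_eq_iff[OF g_nz sym_g g_nz sym_g] by blast
    then have k: "circumconic b' c' = k *\<^sub>R circumconic b c"
      by (metis pull congruence_scaleR)
    have "circumconic b' c' $ i $ j = k * circumconic b c $ i $ j" for i j
      by (simp add: k)
    \<comment> \<open>The normalised entry \<open>(2, 3)\<close> forces \<open>k = 1\<close>.\<close>
    from this[of 2 3] this[of 1 2] this[of 1 3] show ?thesis
      by simp
  qed
  have surj: "\<exists>b c. C = conic_of (g b c)" if "C \<in> ?Q" for C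
  proof -
    have "real_conic C"
      using that by simp
    then obtain A where A: "A \<noteq> 0" "transpose A = A" "C = conic_of A"
      by (rule real_conicE)
    let ?N = "R ** A ** transpose R"
    have "det A \<noteq> 0" "x1 \<bullet> (A *v x1) = 0" "x2 \<bullet> (A *v x2) = 0" "x3 \<bullet> (A *v x3) = 0"
      using that by (simp_all add: conic_solutions_def A(3) nondegenerate_conic_of_iff[OF A(1,2)]
          passes_through_conic_of_iff[OF A(1,2)])
    then have "?N$1$1 = 0" "?N$2$2 = 0" "?N$3$3 = 0" "det ?N \<noteq> 0"
      using detR by (simp_all add: congruence_nth det_mul)
    moreover have "transpose ?N = ?N"
      by (simp add: matrix_transpose_mul A(2) matrix_mul_assoc)
    ultimately obtain a b c where abc: "a \<noteq> 0" "?N = a *\<^sub>R circumconic b c"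
      using symmetric_zero_diagonal_eq_circumconic by metis
    then have "A = a *\<^sub>R g b c"
      using push[of A] by (simp only: g_def congruence_scaleR)
    then show ?thesis
      using conic_of_eq_iff[OF g_nz sym_g A(1,2)] abc(1) A(3) by metis
  qed
  show ?thesis
    unfolding bij_betw_def
  proof
    show "inj_on ?f ?P"
      using inj by (auto simp: inj_on_def g_def)
    show "?f ` ?P = ?Q"
    proof (intro equalityI subsetI)
      fix C assume "C \<in> ?f ` ?P"
      then obtain b c where "b \<noteq> 0" "c \<noteq> 0" "tangency b c (R *v l1) = 0" "tangency b c (R *v l2) = 0"
        "C = conic_of (g b c)"
        by (auto simp: g_def R_def)
      then show "C \<in> ?Q"
        using pass nondeg tang by (simp add: conic_solutions_def real_conic_conic_of[OF g_nz sym_g])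
    next
      fix C assume C: "C \<in> ?Q"
      then obtain b c where bc: "C = conic_of (g b c)"
        using surj by blast
      then have nz: "b \<noteq> 0" "c \<noteq> 0"
        using C nondeg by (auto simp: conic_solutions_def)
      then have "(b, c) \<in> ?P"
        using C bc tang by (auto simp: conic_solutions_def R_def)
      with bc show "C \<in> ?f ` ?P"
        by (intro image_eqI[where x = "(b, c)"]) (simp_all add: g_def)
    qed
  qed
qed

section \<open>Counting the circumconics tangent to two lines\<close>

lemma quadratic_two_roots_iff:
  fixes P Q e d :: real
  assumes "P \<noteq> Q"
  shows "P\<^sup>2 - 2 * e * P + d = 0 \<and> Q\<^sup>2 - 2 * e * Q + d = 0 \<longleftrightarrow> 2 * e = P + Q \<and> d = P * Q"
proof
  assume roots: "P\<^sup>2 - 2 * e * P + d = 0 \<and> Q\<^sup>2 - 2 * e * Q + d = 0"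
  then have "(P - Q) * (P + Q - 2 * e) = 0"
    by (simp add: algebra_simps power2_eq_square)
  then have "2 * e = P + Q"
    using assms by simp
  moreover from this have "d = P * Q"
    using roots by (simp add: power2_eq_square algebra_simps)
  ultimately show "2 * e = P + Q \<and> d = P * Q" ..
next
  assume "2 * e = P + Q \<and> d = P * Q"
  then show "P\<^sup>2 - 2 * e * P + d = 0 \<and> Q\<^sup>2 - 2 * e * Q + d = 0"
    by (simp add: power2_eq_square algebra_simps)
qed

text \<open>The sum of \<open>b s\<close> and \<open>c\<close> is prescribed and their difference is a square root of \<open>P Q\<close>, so a pair
  exists for each real square root. A pair with \<open>b = 0\<close> or \<open>c = 0\<close> would give
  \<open>(P + Q)\<^sup>2 = 4 P Q\<close>, hence \<open>P = Q\<close>.\<close>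

lemma card_sum_diff_square_eq_2_iff:
  fixes P Q s :: real
  assumes "P \<noteq> 0" "Q \<noteq> 0" "s \<noteq> 0" "P \<noteq> Q"
  shows "card {(b, c). b \<noteq> 0 \<and> c \<noteq> 0 \<and> 2 * (b * s + c) = P + Q \<and> (b * s - c)\<^sup>2 = P * Q} = 2 \<longleftrightarrow>
    P * Q > 0" (is "card ?S = 2 \<longleftrightarrow> _")
proof (cases "P * Q > 0")
  case True
  define w where "w = sqrt (P * Q)"
  have w: "w\<^sup>2 = P * Q" "w > 0"
    using True by (simp_all add: w_def)
  let ?sol = "\<lambda>w. (((P + Q) / 2 + w) / (2 * s), ((P + Q) / 2 - w) / 2)"
  have "(P - Q)\<^sup>2 > 0"
    using assms(4) by simp
  then have "((P + Q) / 2)\<^sup>2 \<noteq> w\<^sup>2"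
    using w(1) by (auto simp: power2_eq_square field_simps)
  then have nz: "(P + Q) / 2 + w \<noteq> 0" "(P + Q) / 2 - w \<noteq> 0"
    by (metis add.commute add_eq_0_iff power2_minus, metis eq_iff_diff_eq_0)
  have "?S = {?sol w, ?sol (- w)}"
  proof (intro equalityI subsetI)
    fix z assume "z \<in> ?S"
    then obtain b c where z: "z = (b, c)" "2 * (b * s + c) = P + Q" "(b * s - c)\<^sup>2 = w\<^sup>2"
      using w(1) by auto
    then have "b * s - c = w \<or> b * s - c = - w"
      by (simp add: power2_eq_iff)
    then show "z \<in> {?sol w, ?sol (- w)}"
      using z(1,2) assms(3) by (auto simp: field_simps)
  next
    fix z assume "z \<in> {?sol w, ?sol (- w)}"
    then consider "z = ?sol w" | "z = ?sol (- w)"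
      by blast
    then show "z \<in> ?S"
    proof cases
      case 1
      then show ?thesis
        using nz assms(3) w(1) by (simp add: field_simps)
    next
      case 2
      then show ?thesis
        using nz assms(3) w(1) by (simp add: field_simps)
    qed
  qed
  moreover have "?sol w \<noteq> ?sol (- w)"
    using w(2) by simp
  ultimately show ?thesis
    using True by (simp only: card_2_iff) blast
next
  case False
  then have "P * Q < 0"
    using assms(1,2) by (metis linorder_neqE mult_eq_0_iff)
  then have "?S = {}"
    by (smt (verit) Collect_empty_eq case_prodE zero_le_power2)
  then have "card ?S = 0"
    by (simp only: card.empty)
  with False show ?thesis
    by simp
qed

text \<open>In incidence coordinates, \<open>meet\<close> expresses that the two lines intersect on the side \<open>x = 0\<close>. After
  division by the squares of the third coordinates, both tangency conditions become the same
  quadratic equation, for \<open>P\<close> and for \<open>Q\<close>.\<close>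

lemma card_tangent_circumconics_eq_2_iff:
  fixes m n :: "real^3"
  assumes nz: "\<And>i. m$i \<noteq> 0" "\<And>i. n$i \<noteq> 0"
    and meet: "m$2 * n$3 = m$3 * n$2" and distinct: "m$1 * n$3 \<noteq> m$3 * n$1"
  shows "card {(b, c). b \<noteq> 0 \<and> c \<noteq> 0 \<and> tangency b c m = 0 \<and> tangency b c n = 0} = 2 \<longleftrightarrow>
    sgn (m$1 * m$3) = sgn (n$1 * n$3)"
proof -
  define P Q s where "P = m$1 / m$3" and "Q = n$1 / n$3" and "s = m$2 / m$3"
  have m: "m$1 = P * m$3" "m$2 = s * m$3" and n: "n$1 = Q * n$3" "n$2 = s * n$3"
    using nz(1)[of 3] nz(2)[of 3] meet by (simp_all add: P_def Q_def s_def field_simps)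
  have PQs: "P \<noteq> 0" "Q \<noteq> 0" "s \<noteq> 0"
    using nz by (simp_all add: P_def Q_def s_def)
  have "P \<noteq> Q"
    using distinct m(1) n(1) by auto
  have tangency_eq: "tangency b c v = (v$3)\<^sup>2 * (p\<^sup>2 - 2 * (b * s + c) * p + (b * s - c)\<^sup>2)"
    if "v$1 = p * v$3" "v$2 = s * v$3" for v :: "real^3" and b c p
    unfolding tangency_def that by (simp add: power2_eq_square algebra_simps)
  have "tangency b c m = 0 \<and> tangency b c n = 0 \<longleftrightarrow>
      2 * (b * s + c) = P + Q \<and> (b * s - c)\<^sup>2 = P * Q" for b c
    unfolding quadratic_two_roots_iff[OF \<open>P \<noteq> Q\<close>, symmetric]
    using nz(1)[of 3] nz(2)[of 3] by (simp add: tangency_eq[OF m] tangency_eq[OF n])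
  then have "card {(b, c). b \<noteq> 0 \<and> c \<noteq> 0 \<and> tangency b c m = 0 \<and> tangency b c n = 0} = 2 \<longleftrightarrow>
      P * Q > 0"
    using card_sum_diff_square_eq_2_iff[OF PQs \<open>P \<noteq> Q\<close>] by simp
  also have "\<dots> \<longleftrightarrow> sgn P = sgn Q"
    using PQs by (auto simp: sgn_if zero_less_mult_iff split: if_splits)
  also have "sgn P = sgn (m$1 * m$3)"
    using nz(1)[of 3] by (simp add: P_def sgn_if zero_less_mult_iff zero_less_divide_iff)
  also have "sgn Q = sgn (n$1 * n$3)"
    using nz(2)[of 3] by (simp add: Q_def sgn_if zero_less_mult_iff zero_less_divide_iff)
  finally show ?thesis .
qed

section \<open>Incidence vectors of two lines that meet on a side\<close>

text \<open>The coefficients on the right are the coordinates of the intersection point of the two lines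
  with respect to the triangle. So this point lies on the side through \<open>x2\<close> and \<open>x3\<close> iff the first
  coefficient vanishes, and it is a vertex iff only one coefficient is nonzero.\<close>

lemma det_scaleR_cross3_eq_sum_rows:
  fixes x1 x2 x3 l m :: "real^3"
  shows "det (vector [x1, x2, x3] :: real^3^3) *\<^sub>R cross3 l m =
      ((x2 \<bullet> l) * (x3 \<bullet> m) - (x3 \<bullet> l) * (x2 \<bullet> m)) *\<^sub>R x1 +
      ((x3 \<bullet> l) * (x1 \<bullet> m) - (x1 \<bullet> l) * (x3 \<bullet> m)) *\<^sub>R x2 +
      ((x1 \<bullet> l) * (x2 \<bullet> m) - (x2 \<bullet> l) * (x1 \<bullet> m)) *\<^sub>R x3"
proof -
  let ?R = "vector [x1, x2, x3] :: real^3^3"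
  have "transpose ?R *v v = v$1 *\<^sub>R x1 + v$2 *\<^sub>R x2 + v$3 *\<^sub>R x3" for v
    by (simp add: vec_eq_iff matrix_vector_mult_def transpose_def sum_3 algebra_simps
        del: transpose_matrix_vector)
  then show ?thesis
    unfolding cross_matrix_mult[symmetric]
    by (simp add: cross3_def[of "?R *v l"] matrix_vector_mul_component)
qed

theorem proposition4:
  fixes x1 x2 x3 l1 l2 :: "real^3"
  assumes "finite_point x1" "finite_point x2" "finite_point x3"
    and "l1 \<noteq> 0" "l2 \<noteq> 0" "\<not> proj_eq l1 l2"
    and "general_position x1 x2 x3 l1 l2"
    and "x1 \<bullet> l1 \<noteq> 0" "x1 \<bullet> l2 \<noteq> 0"
    and "proj_collinear x2 x3 (cross3 l1 l2)"
  shows "card {C \<in> conic_solutions x1 x2 x3 l1 l2. real_conic C} = 2 \<longleftrightarrow>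
     sgn ((x1 \<bullet> l1) * (x3 \<bullet> l1)) = sgn ((x1 \<bullet> l2) * (x3 \<bullet> l2))"
proof -
  define R :: "real^3^3" where "R = vector [x1, x2, x3]"
  have R [simp]: "(R *v v) $ 1 = x1 \<bullet> v" "(R *v v) $ 2 = x2 \<bullet> v" "(R *v v) $ 3 = x3 \<bullet> v" for v
    by (simp_all add: R_def matrix_vector_mul_component)
  have "\<not> proj_collinear x1 x2 x3"
    using assms(7) by (simp add: general_position_def)
  then have ker: "v = 0" if "R *v v = 0" for v
    using that R[of v] by (auto simp: proj_collinear_def on_line_def)
  then obtain S where S: "S ** R = mat 1"
    using matrix_left_invertible_ker[of R] by blast
  then have RS: "R ** S = mat 1"
    by (simp add: matrix_left_right_inverse)
  have detR: "det R \<noteq> 0"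
    using RS by (metis det_I det_mul mult_zero_left zero_neq_one)
  have cross_nz: "cross3 l1 l2 \<noteq> 0"
  proof
    assume "cross3 l1 l2 = 0"
    then obtain k where "l2 = k *\<^sub>R l1"
      using assms(4,5) by (auto simp: cross_eq_0 collinear_lemma)
    then show False
      using assms(5,6) by (auto simp: proj_eq_def)
  qed
  note cross = det_scaleR_cross3_eq_sum_rows[of x1 x2 x3 l1 l2, folded R_def]
  have meet: "(x2 \<bullet> l1) * (x3 \<bullet> l2) = (x3 \<bullet> l1) * (x2 \<bullet> l2)"
  proof -
    obtain l where l: "l \<noteq> 0" "x2 \<bullet> l = 0" "x3 \<bullet> l = 0" "cross3 l1 l2 \<bullet> l = 0"
      using assms(10) by (auto simp: proj_collinear_def on_line_def)
    \<comment> \<open>The line \<open>l\<close> is the side through \<open>x2\<close> and \<open>x3\<close>, so it misses \<open>x1\<close>.\<close>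
    have "x1 \<bullet> l \<noteq> 0"
      using l ker[of l] by (auto simp: vec_eq_iff forall_3)
    have "0 = (det R *\<^sub>R cross3 l1 l2) \<bullet> l"
      using l(4) by simp
    also have "\<dots> = ((x2 \<bullet> l1) * (x3 \<bullet> l2) - (x3 \<bullet> l1) * (x2 \<bullet> l2)) * (x1 \<bullet> l)"
      unfolding cross by (simp add: inner_add_left l(2,3))
    finally show ?thesis
      using \<open>x1 \<bullet> l \<noteq> 0\<close> by simp
  qed
  have vertex: "\<not> proj_eq (cross3 l1 l2) x2" "\<not> proj_eq (cross3 l1 l2) x3"
    using assms(7) by (simp_all add: general_position_def is_vertex_def)
  have multiple: "proj_eq (cross3 l1 l2) x" if "det R *\<^sub>R cross3 l1 l2 = k *\<^sub>R x" for k x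
  proof -
    have "k \<noteq> 0"
      using that detR cross_nz by auto
    then have "x = (det R / k) *\<^sub>R cross3 l1 l2"
      using that by (simp add: vec_eq_iff field_simps)
    then show ?thesis
      unfolding proj_eq_def using \<open>k \<noteq> 0\<close> detR by (intro exI[of _ "det R / k"]) simp
  qed
  \<comment> \<open>If \<open>x2 \<bullet> l1\<close> or \<open>x2 \<bullet> l2\<close> vanished, then by \<open>meet\<close> so would the other one, neither line
    being a side, and both lines would pass through \<open>x2\<close>; the same holds for \<open>x3\<close>.\<close>
  have no2: "\<not> (x2 \<bullet> l1 = 0 \<and> x2 \<bullet> l2 = 0)"
    using multiple[of "(x3 \<bullet> l1) * (x1 \<bullet> l2) - (x1 \<bullet> l1) * (x3 \<bullet> l2)" x2] vertex(1) cross by auto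
  have no3: "\<not> (x3 \<bullet> l1 = 0 \<and> x3 \<bullet> l2 = 0)"
    using multiple[of "(x1 \<bullet> l1) * (x2 \<bullet> l2) - (x2 \<bullet> l1) * (x1 \<bullet> l2)" x3] vertex(2) cross by auto
  have side: "x2 \<bullet> l1 \<noteq> 0 \<or> x3 \<bullet> l1 \<noteq> 0" "x2 \<bullet> l2 \<noteq> 0 \<or> x3 \<bullet> l2 \<noteq> 0"
    using assms(7) by (auto simp: general_position_def is_side_def on_line_def)
  have nz: "x2 \<bullet> l1 \<noteq> 0" "x3 \<bullet> l1 \<noteq> 0" "x2 \<bullet> l2 \<noteq> 0" "x3 \<bullet> l2 \<noteq> 0"
    using side no2 no3 meet by auto
  have distinct: "(x1 \<bullet> l1) * (x3 \<bullet> l2) \<noteq> (x3 \<bullet> l1) * (x1 \<bullet> l2)"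
  proof
    assume eq: "(x1 \<bullet> l1) * (x3 \<bullet> l2) = (x3 \<bullet> l1) * (x1 \<bullet> l2)"
    define k where "k = (x3 \<bullet> l2) / (x3 \<bullet> l1)"
    have "R *v (l2 - k *\<^sub>R l1) = 0"
      using eq meet nz by (simp add: vec_eq_iff forall_3 k_def inner_diff_right field_simps)
    then have "l2 = k *\<^sub>R l1"
      using ker by fastforce
    moreover have "k \<noteq> 0"
      using nz by (simp add: k_def)
    ultimately show False
      using assms(6) by (auto simp: proj_eq_def)
  qed
  have "\<And>i. (R *v l1) $ i \<noteq> 0" "\<And>i. (R *v l2) $ i \<noteq> 0"
    using nz assms(8,9) by (metis R exhaust_3)+
  from card_tangent_circumconics_eq_2_iff[OF this]
  have "card {(b, c). b \<noteq> 0 \<and> c \<noteq> 0 \<and> tangency b c (R *v l1) = 0 \<and> tangency b c (R *v l2) = 0} = 2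
      \<longleftrightarrow> sgn ((x1 \<bullet> l1) * (x3 \<bullet> l1)) = sgn ((x1 \<bullet> l2) * (x3 \<bullet> l2))"
    using meet distinct by simp
  then show ?thesis
    using bij_betw_same_card[OF bij_betw_circumconics_solutions[OF RS[unfolded R_def] S[unfolded R_def]]]
    by (simp add: R_def)
qed

end
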